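(* For all integers $1\le k\le n$, $$\mathfrak{WB}_{n,k}(x):=\sum_{\pi\in B_n}x^{\mathrm{des}_k^B(\pi)}=\sum_{p=0}^{\lfloor (n-k+1)/2\rfloor}\gamma^B_{n,k,p}\,x^p(1+x)^{n-k+1-2p},$$ where $\gamma^B_{n,k,p}=2^{2p+k-1}\,|\Gamma^{(\ell)}_{n,k,p}|$ and $\Gamma^{(\ell)}_{n,k,p}$ is the set of permutations $\sigma\in\mathfrak{S}_n$ with exactly $p$ width-$k$ left peaks, i.e. $\mathrm{lpeak}_k(\sigma)=p$.
   Context: $B_n$ is the set of signed permutations of $[n]$: bijections $\pi$ of $\{\pm1,\dots,\pm n\}$ with $\pi(-i)=-\pi(i)$, written $\pi=(\pi(1),\dots,\pi(n))$; set $\pi(0)=0$. $\mathrm{des}_k^B(\pi)=|\{0\le i\le n-k:\pi(i)>\pi(i+k)\}|$. $\mathfrak{S}_n$ is the symmetric group on $[n]$. For $\sigma\in\mathfrak{S}_n$, with convention $\sigma(0)=0$, the set of width-$k$ left peaks is $\mathrm{Lpeak}_k(\sigma)=\{k\le i\le n-k:\sigma(i-k)<\sigma(i)>\sigma(i+k)\}$ and $\mathrm{lpeak}_k(\sigma)=|\mathrm{Lpeak}_k(\sigma)|$. *)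

theory Defs
  imports "HOL-Combinatorics.Permutations" "HOL-Computational_Algebra.Polynomial"
begin

text \<open>
  Permutations are represented as functions via \<open>permutes\<close>, i.e. as the identity outside the
  permuted set. As 0 never belongs to that set, the conventions \<open>\<pi> 0 = 0\<close> and \<open>\<sigma> 0 = 0\<close>
  hold automatically.
\<close>

definition signed_perms :: "nat \<Rightarrow> (int \<Rightarrow> int) set" where
  "signed_perms n =
     {\<pi>. \<pi> permutes ({- int n..-1} \<union> {1..int n}) \<and>
         (\<forall>i \<in> {- int n..-1} \<union> {1..int n}. \<pi> (- i) = - \<pi> i)}"

definition desB :: "nat \<Rightarrow> nat \<Rightarrow> (int \<Rightarrow> int) \<Rightarrow> nat" where
  "desB n k \<pi> = card {i::nat. i + k \<le> n \<and> \<pi> (int i) > \<pi> (int (i + k))}"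

definition WB :: "nat \<Rightarrow> nat \<Rightarrow> int poly" where
  "WB n k = (\<Sum>\<pi>\<in>signed_perms n. [:0, 1:] ^ desB n k \<pi>)"

definition Lpeak :: "nat \<Rightarrow> nat \<Rightarrow> (nat \<Rightarrow> nat) \<Rightarrow> nat set" where
  "Lpeak n k \<sigma> = {i. k \<le> i \<and> i + k \<le> n \<and> \<sigma> (i - k) < \<sigma> i \<and> \<sigma> i > \<sigma> (i + k)}"

definition lpeak :: "nat \<Rightarrow> nat \<Rightarrow> (nat \<Rightarrow> nat) \<Rightarrow> nat" where
  "lpeak n k \<sigma> = card (Lpeak n k \<sigma>)"

definition Gamma_l :: "nat \<Rightarrow> nat \<Rightarrow> nat \<Rightarrow> (nat \<Rightarrow> nat) set" where
  "Gamma_l n k p = {\<sigma>. \<sigma> permutes {1..n} \<and> lpeak n k \<sigma> = p}"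

definition gammaB :: "nat \<Rightarrow> nat \<Rightarrow> nat \<Rightarrow> nat" where
  "gammaB n k p = 2 ^ (2 * p + k - 1) * card (Gamma_l n k p)"

end

theory Submission imports Defs begin

text \<open>
  Fix \<open>\<sigma> = |\<pi>|\<close> and sum over all choices of signs. A pair of positions \<open>(i, i + k)\<close> is a descent
  of \<open>\<pi>\<close> or not depending only on the sign of the entry that is larger in absolute value: it must
  be negative if it stands on the right and positive if it stands on the left. So the signs
  contribute independently: a position that is the larger one in both of its pairs (a left peak)
  contributes the factor \<open>x + x\<close>, one that is the larger one in exactly one pair contributes
  \<open>1 + x\<close>, and any other contributes 2. Counting the \<open>n - k + 1\<close> pairs by their larger entry gives
  \<open>n - k + 1 - 2p\<close> positions of the second kind, if \<open>p\<close> is the number of left peaks.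
\<close>

subsection \<open>Signed permutations as permutations with a set of negative positions\<close>

text \<open>\<open>S\<close> collects positions, not values, that carry a minus sign. The factor
  \<open>sgn i\<close> makes the function odd for every \<open>S\<close> and gives the value 0 at 0
  without a case distinction.\<close>

definition attach_signs :: "(nat \<Rightarrow> nat) \<Rightarrow> nat set \<Rightarrow> int \<Rightarrow> int" where
  "attach_signs \<sigma> S i = (if nat \<bar>i\<bar> \<in> S then - sgn i else sgn i) * int (\<sigma> (nat \<bar>i\<bar>))"

definition abs_perm :: "(int \<Rightarrow> int) \<Rightarrow> nat \<Rightarrow> nat" where
  "abs_perm \<pi> j = nat \<bar>\<pi> (int j)\<bar>"

definition neg_positions :: "nat \<Rightarrow> (int \<Rightarrow> int) \<Rightarrow> nat set" where
  "neg_positions n \<pi> = {j \<in> {1..n}. \<pi> (int j) < 0}"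

lemma permutes_finite_injI:
  assumes "finite A" "inj_on f A" "\<And>x. x \<in> A \<Longrightarrow> f x \<in> A" "\<And>x. x \<notin> A \<Longrightarrow> f x = x"
  shows "f permutes A"
proof (rule bij_imp_permutes)
  show "bij_betw f A A"
    using endo_inj_surj[of A f] assms by (auto simp: bij_betw_def)
qed (use assms in auto)

lemma permutes_zero:
  assumes "\<sigma> permutes {1..n::nat}"
  shows "\<sigma> 0 = 0"
  using permutes_not_in[OF assms, of 0] by simp

lemma permutes_pos:
  assumes "\<sigma> permutes {1..n::nat}" "0 < j"
  shows "0 < \<sigma> j"
  using permutes_inj[OF assms(1)] permutes_zero[OF assms(1)] assms(2)
  by (metis injD gr_zeroI)

lemma signed_perms_permutes:
  assumes "\<pi> \<in> signed_perms n"
  shows "\<pi> permutes ({- int n..-1} \<union> {1..int n})"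
  using assms by (simp add: signed_perms_def)

lemma signed_perms_odd:
  assumes "\<pi> \<in> signed_perms n"
  shows "\<pi> (- i) = - \<pi> i"
proof (cases "i \<in> {- int n..-1} \<union> {1..int n}")
  case False
  then have "- i \<notin> {- int n..-1} \<union> {1..int n}" by auto
  then show ?thesis
    using permutes_not_in[OF signed_perms_permutes[OF assms]] False by metis
qed (use assms in \<open>auto simp: signed_perms_def\<close>)

lemma attach_signs_int:
  assumes "\<sigma> permutes {1..n}"
  shows "attach_signs \<sigma> S (int i) = (if i \<in> S then - int (\<sigma> i) else int (\<sigma> i))"
  using permutes_zero[OF assms] by (cases "i = 0") (auto simp: attach_signs_def)

lemma attach_signs_minus: "attach_signs \<sigma> S (- i) = - attach_signs \<sigma> S i"
  by (simp add: attach_signs_def)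

lemma nat_abs_attach_signs:
  assumes "\<sigma> permutes {1..n}"
  shows "nat \<bar>attach_signs \<sigma> S i\<bar> = \<sigma> (nat \<bar>i\<bar>)"
  using permutes_zero[OF assms] by (auto simp: attach_signs_def abs_mult abs_sgn_eq)

lemma attach_signs_in_signed_perms:
  assumes \<sigma>: "\<sigma> permutes {1..n}" and S: "S \<subseteq> {1..n}"
  shows "attach_signs \<sigma> S \<in> signed_perms n"
proof -
  let ?I = "{- int n..-1} \<union> {1..int n}"
  have I: "i \<in> ?I \<longleftrightarrow> nat \<bar>i\<bar> \<in> {1..n}" for i by auto
  have "attach_signs \<sigma> S permutes ?I"
  proof (rule permutes_finite_injI)
    show "inj_on (attach_signs \<sigma> S) ?I"
    proof (rule inj_onI)
      fix i j assume ij: "i \<in> ?I" "j \<in> ?I" and eq: "attach_signs \<sigma> S i = attach_signs \<sigma> S j"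
      have "\<sigma> (nat \<bar>i\<bar>) = \<sigma> (nat \<bar>j\<bar>)"
        using eq nat_abs_attach_signs[OF \<sigma>] by metis
      then have "nat \<bar>i\<bar> = nat \<bar>j\<bar>" by (simp only: inj_eq[OF permutes_inj[OF \<sigma>]])
      then have "i = j \<or> i = - j" by linarith
      \<comment> \<open>If \<open>i = - j\<close>, oddness would force the common value to be its
        own negative, hence 0, but \<open>\<sigma>\<close> is positive at positive
        arguments.\<close>
      moreover have "i \<noteq> - j"
      proof
        assume "i = - j"
        with eq have "attach_signs \<sigma> S j = 0" by (simp add: attach_signs_minus)
        then have "\<sigma> (nat \<bar>j\<bar>) = 0" using nat_abs_attach_signs[OF \<sigma>, of S j] by simp
        moreover have "0 < nat \<bar>j\<bar>" using ij by auto
        ultimately show False using permutes_pos[OF \<sigma>, of "nat \<bar>j\<bar>"] by simp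
      qed
      ultimately show "i = j" by blast
    qed
    show "attach_signs \<sigma> S i \<in> ?I" if "i \<in> ?I" for i
      unfolding I nat_abs_attach_signs[OF \<sigma>] using that permutes_in_image[OF \<sigma>] I by blast
    show "attach_signs \<sigma> S i = i" if "i \<notin> ?I" for i
    proof -
      have "nat \<bar>i\<bar> \<notin> {1..n}" using that I by blast
      then have "\<sigma> (nat \<bar>i\<bar>) = nat \<bar>i\<bar>" "nat \<bar>i\<bar> \<notin> S"
        using permutes_not_in[OF \<sigma>] S by auto
      then show ?thesis by (simp add: attach_signs_def sgn_mult_abs)
    qed
  qed simp
  then show ?thesis by (simp add: signed_perms_def attach_signs_minus)
qed

lemma abs_perm_permutes:
  assumes \<pi>: "\<pi> \<in> signed_perms n"
  shows "abs_perm \<pi> permutes {1..n}"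
proof (rule permutes_finite_injI)
  note perm = signed_perms_permutes[OF \<pi>]
  show "inj_on (abs_perm \<pi>) {1..n}"
  proof (rule inj_onI)
    fix a b assume "a \<in> {1..n}" "b \<in> {1..n}" "abs_perm \<pi> a = abs_perm \<pi> b"
    \<comment> \<open>Equal absolute values mean equal or opposite values. Oddness rewrites the
      opposite value as the value at \<open>- int b\<close>, so injectivity of \<open>\<pi>\<close>
      settles both cases.\<close>
    then have "\<pi> (int a) = \<pi> (int b) \<or> \<pi> (int a) = \<pi> (- int b)"
      unfolding abs_perm_def signed_perms_odd[OF \<pi>] by linarith
    then have "int a = int b \<or> int a = - int b"
      by (simp only: inj_eq[OF permutes_inj[OF perm]])
    then show "a = b" by linarith
  qed
  show "abs_perm \<pi> j \<in> {1..n}" if "j \<in> {1..n}" for j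
  proof -
    have "\<pi> (int j) \<in> {- int n..-1} \<union> {1..int n}"
      using permutes_in_image[OF perm, of "int j"] that by auto
    then show ?thesis by (auto simp: abs_perm_def)
  qed
  show "abs_perm \<pi> j = j" if "j \<notin> {1..n}" for j
    using permutes_not_in[OF perm, of "int j"] that by (auto simp: abs_perm_def)
qed simp

lemma attach_signs_abs_perm:
  assumes \<pi>: "\<pi> \<in> signed_perms n"
  shows "attach_signs (abs_perm \<pi>) (neg_positions n \<pi>) = \<pi>"
proof
  fix i
  let ?\<rho> = "attach_signs (abs_perm \<pi>) (neg_positions n \<pi>)"
  have nat: "?\<rho> (int j) = \<pi> (int j)" for j
  proof (cases "j \<in> {1..n}")
    case True
    then show ?thesis
      by (auto simp: attach_signs_int[OF abs_perm_permutes[OF \<pi>]] abs_perm_def neg_positions_def)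
  next
    case False
    then have "\<pi> (int j) = int j"
      using permutes_not_in[OF signed_perms_permutes[OF \<pi>], of "int j"] by auto
    then show ?thesis
      by (auto simp: attach_signs_int[OF abs_perm_permutes[OF \<pi>]] abs_perm_def neg_positions_def)
  qed
  show "?\<rho> i = \<pi> i"
    by (cases i rule: int_cases2) (simp_all add: nat attach_signs_minus signed_perms_odd[OF \<pi>])
qed

lemma abs_perm_attach_signs:
  assumes "\<sigma> permutes {1..n}"
  shows "abs_perm (attach_signs \<sigma> S) = \<sigma>"
  by (simp add: fun_eq_iff abs_perm_def nat_abs_attach_signs[OF assms])

lemma neg_positions_attach_signs:
  assumes "\<sigma> permutes {1..n}" "S \<subseteq> {1..n}"
  shows "neg_positions n (attach_signs \<sigma> S) = S"
  using assms(2) permutes_pos[OF assms(1)]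
  by (auto simp: neg_positions_def attach_signs_int[OF assms(1)] split: if_splits)

text \<open>The pair of \<open>abs_perm\<close> and \<open>neg_positions\<close> inverts
  \<open>attach_signs\<close>, so a signed permutation amounts to a permutation together with a free
  choice of signs.\<close>

lemma sum_signed_perms:
  "(\<Sum>\<pi>\<in>signed_perms n. f \<pi>) =
   (\<Sum>\<sigma> | \<sigma> permutes {1..n}. \<Sum>S\<in>Pow {1..n}. f (attach_signs \<sigma> S))"
  unfolding sum.cartesian_product
  by (rule sum.reindex_bij_witness[where i = "\<lambda>(\<sigma>, S). attach_signs \<sigma> S"
        and j = "\<lambda>\<pi>. (abs_perm \<pi>, neg_positions n \<pi>)"])
    (auto simp: attach_signs_abs_perm abs_perm_attach_signs neg_positions_attach_signs
       attach_signs_in_signed_perms abs_perm_permutes simp del: One_nat_def,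
      auto simp: neg_positions_def)

subsection \<open>Positions that dominate a neighbour at distance k\<close>

text \<open>A pair \<open>(i, i + k)\<close> is recorded by the position of its larger entry: here
  if that is the right end, in \<open>descent_tops\<close> if it is the left end.\<close>

definition ascent_tops :: "nat \<Rightarrow> nat \<Rightarrow> (nat \<Rightarrow> nat) \<Rightarrow> nat set" where
  "ascent_tops n k \<sigma> = {i. k \<le> i \<and> i \<le> n \<and> \<sigma> (i - k) < \<sigma> i}"

definition descent_tops :: "nat \<Rightarrow> nat \<Rightarrow> (nat \<Rightarrow> nat) \<Rightarrow> nat set" where
  "descent_tops n k \<sigma> = {i. i + k \<le> n \<and> \<sigma> (i + k) < \<sigma> i}"

lemma Lpeak_eq_Int: "Lpeak n k \<sigma> = ascent_tops n k \<sigma> \<inter> descent_tops n k \<sigma>"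
  by (auto simp: Lpeak_def ascent_tops_def descent_tops_def)

lemma ascent_tops_subset: "1 \<le> k \<Longrightarrow> ascent_tops n k \<sigma> \<subseteq> {1..n}"
  by (auto simp: ascent_tops_def)

lemma descent_tops_subset:
  assumes "\<sigma> permutes {1..n}"
  shows "descent_tops n k \<sigma> \<subseteq> {1..n}"
  using permutes_zero[OF assms] by (auto simp: descent_tops_def Suc_le_eq intro!: gr_zeroI)

lemma finite_tops [simp]: "finite (ascent_tops n k \<sigma>)" "finite (descent_tops n k \<sigma>)"
  by (rule finite_subset[of _ "{..n}"]; auto simp: ascent_tops_def descent_tops_def)+

lemma card_shift_eq:
  fixes T :: "nat set"
  assumes "\<And>i. i \<in> T \<Longrightarrow> k \<le> i"
  shows "card {i. i + k \<in> T} = card T"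
proof (rule bij_betw_same_card)
  show "bij_betw (\<lambda>i. i + k) {i. i + k \<in> T} T"
    by (rule bij_betwI[where g = "\<lambda>i. i - k"]) (use assms in auto)
qed

lemma finite_shift:
  fixes T :: "nat set"
  assumes "finite T"
  shows "finite {i. i + k \<in> T}"
  using finite_vimageI[OF assms, of "\<lambda>i. i + k"] by (simp add: vimage_def)

text \<open>Each pair \<open>(i, i + k)\<close> with \<open>i \<le> n - k\<close> has exactly one
  larger entry, as \<open>\<sigma>\<close> is injective and \<open>k\<close> is positive. Shifting
  the ascent tops down by \<open>k\<close> indexes all pairs by their left ends, including the pair
  starting at 0.\<close>

lemma card_tops:
  assumes \<sigma>: "\<sigma> permutes {1..n}" and k: "1 \<le> k" "k \<le> n"
  shows "card (ascent_tops n k \<sigma>) + card (descent_tops n k \<sigma>) = n - k + 1"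
proof -
  let ?U = "ascent_tops n k \<sigma>" and ?D = "descent_tops n k \<sigma>"
  have neq: "\<sigma> i \<noteq> \<sigma> (i + k)" for i
    using k by (simp add: inj_eq[OF permutes_inj[OF \<sigma>]])
  have "card ?U + card ?D = card {i. i + k \<in> ?U} + card ?D"
    by (subst card_shift_eq) (auto simp: ascent_tops_def)
  also have "\<dots> = card ({i. i + k \<in> ?U} \<union> ?D)"
  proof (rule card_Un_disjoint[symmetric])
    show "finite {i. i + k \<in> ?U}" by (rule finite_shift) simp
    show "{i. i + k \<in> ?U} \<inter> ?D = {}" by (auto simp: ascent_tops_def descent_tops_def)
  qed simp
  also have "{i. i + k \<in> ?U} \<union> ?D = {..n - k}"
    using k neq by (auto simp: ascent_tops_def descent_tops_def neq_iff)
  finally show ?thesis by simp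
qed

text \<open>The larger entry of a pair decides the comparison whatever sign the smaller one has: a
  descent arises from a negative right end or a positive left end.\<close>

lemma desB_attach_signs:
  assumes \<sigma>: "\<sigma> permutes {1..n}" and k: "1 \<le> k"
  shows "desB n k (attach_signs \<sigma> S) =
    card (S \<inter> ascent_tops n k \<sigma>) + card (({1..n} - S) \<inter> descent_tops n k \<sigma>)"
proof -
  let ?U = "S \<inter> ascent_tops n k \<sigma>" and ?D = "({1..n} - S) \<inter> descent_tops n k \<sigma>"
  have neq: "\<sigma> i \<noteq> \<sigma> (i + k)" for i
    using k by (simp add: inj_eq[OF permutes_inj[OF \<sigma>]])
  have "i + k \<le> n \<and> attach_signs \<sigma> S (int i) > attach_signs \<sigma> S (int (i + k)) \<longleftrightarrow>
      i + k \<in> ?U \<or> i \<in> ?D" for i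
  proof (cases "\<sigma> i < \<sigma> (i + k)")
    case True
    then show ?thesis
      unfolding attach_signs_int[OF \<sigma>] by (auto simp: ascent_tops_def descent_tops_def)
  next
    case False
    then have less: "\<sigma> (i + k) < \<sigma> i" using neq[of i] by simp
    \<comment> \<open>Only for \<open>i\<close> in \<open>{1..n}\<close> does not being negative
      mean membership in \<open>{1..n} - S\<close>.\<close>
    then have "i \<noteq> 0" using permutes_zero[OF \<sigma>] by (intro notI) simp
    then show ?thesis
      using less unfolding attach_signs_int[OF \<sigma>]
      by (auto simp: ascent_tops_def descent_tops_def)
  qed
  then have "{i. i + k \<le> n \<and> attach_signs \<sigma> S (int i) > attach_signs \<sigma> S (int (i + k))}
      = {i. i + k \<in> ?U} \<union> ?D"
    by blast
  then have "desB n k (attach_signs \<sigma> S) = card ({i. i + k \<in> ?U} \<union> ?D)"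
    by (simp only: desB_def)
  also have "\<dots> = card {i. i + k \<in> ?U} + card ?D"
  proof (rule card_Un_disjoint)
    show "finite {i. i + k \<in> ?U}" by (rule finite_shift) simp
    show "{i. i + k \<in> ?U} \<inter> ?D = {}" by (auto simp: ascent_tops_def descent_tops_def)
  qed simp
  also have "card {i. i + k \<in> ?U} = card ?U"
    by (rule card_shift_eq) (auto simp: ascent_tops_def)
  finally show ?thesis .
qed

section \<open>Summing over all signs for a fixed underlying permutation\<close>

lemma prod_if_mem_power:
  fixes x :: "'a :: comm_monoid_mult"
  assumes "finite A"
  shows "(\<Prod>i\<in>A. if i \<in> T then x else 1) = x ^ card (A \<inter> T)"
  using assms by (simp add: prod.If_cases)

text \<open>Sort the factors: \<open>2 * x\<close> on both sets, \<open>1 + x\<close> on exactly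
  one, 2 on neither.\<close>

lemma prod_sum_indicators:
  fixes x :: "'a :: comm_semiring_1"
  assumes A: "finite A" and UD: "U \<subseteq> A" "D \<subseteq> A"
  shows "(\<Prod>i\<in>A. (if i \<in> U then x else 1) + (if i \<in> D then x else 1)) =
    (2 * x) ^ card (U \<inter> D) * (1 + x) ^ (card (U \<union> D) - card (U \<inter> D)) * 2 ^ (card A - card (U \<union> D))"
proof -
  have fin: "finite U" "finite D" using UD A by (auto intro: finite_subset)
  have "(\<Prod>i\<in>A. (if i \<in> U then x else 1) + (if i \<in> D then x else 1)) =
      (\<Prod>i\<in>A. (if i \<in> U \<inter> D then 2 * x else 1) *
        (if i \<in> U \<union> D - U \<inter> D then 1 + x else 1) * (if i \<in> A - (U \<union> D) then 2 else 1))"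
    by (rule prod.cong) (auto simp: mult_2 add.commute)
  also have "\<dots> = (2 * x) ^ card (A \<inter> (U \<inter> D)) * (1 + x) ^ card (A \<inter> (U \<union> D - U \<inter> D)) *
      2 ^ card (A \<inter> (A - (U \<union> D)))"
    unfolding prod.distrib prod_if_mem_power[OF A] ..
  also have "A \<inter> (U \<inter> D) = U \<inter> D" using UD by auto
  also have "A \<inter> (U \<union> D - U \<inter> D) = U \<union> D - U \<inter> D" using UD by auto
  also have "A \<inter> (A - (U \<union> D)) = A - (U \<union> D)" by auto
  also have "card (U \<union> D - U \<inter> D) = card (U \<union> D) - card (U \<inter> D)"
    by (rule card_Diff_subset) (use UD fin in auto)
  also have "card (A - (U \<union> D)) = card A - card (U \<union> D)"
    by (rule card_Diff_subset) (use UD fin in auto)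
  finally show ?thesis .
qed

lemma card_tops_Un:
  assumes \<sigma>: "\<sigma> permutes {1..n}" and k: "1 \<le> k" "k \<le> n"
  shows "card (ascent_tops n k \<sigma> \<union> descent_tops n k \<sigma>) + lpeak n k \<sigma> = n - k + 1"
  unfolding lpeak_def Lpeak_eq_Int card_tops[OF assms, symmetric]
  by (rule card_Un_Int[symmetric]) simp_all

text \<open>The intersection of the two sets of tops is no larger than their union, and their sizes
  add up to \<open>n - k + 1\<close>. This bounds the range of \<open>p\<close> and keeps the
  natural subtractions exact.\<close>

lemma lpeak_le:
  assumes \<sigma>: "\<sigma> permutes {1..n}" and k: "1 \<le> k" "k \<le> n"
  shows "2 * lpeak n k \<sigma> \<le> n - k + 1"
proof -
  have "lpeak n k \<sigma> \<le> card (ascent_tops n k \<sigma> \<union> descent_tops n k \<sigma>)"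
    unfolding lpeak_def Lpeak_eq_Int
    by (rule card_mono) auto
  then show ?thesis using card_tops_Un[OF assms] by simp
qed

lemma sum_signs_desB:
  fixes x :: "'a :: comm_semiring_1"
  assumes \<sigma>: "\<sigma> permutes {1..n}" and k: "1 \<le> k" "k \<le> n"
  defines "p \<equiv> lpeak n k \<sigma>"
  shows "(\<Sum>S\<in>Pow {1..n}. x ^ desB n k (attach_signs \<sigma> S)) =
    2 ^ (2 * p + k - 1) * x ^ p * (1 + x) ^ (n - k + 1 - 2 * p)"
proof -
  let ?U = "ascent_tops n k \<sigma>" and ?D = "descent_tops n k \<sigma>"
  have UD: "?U \<subseteq> {1..n}" "?D \<subseteq> {1..n}"
    using ascent_tops_subset[OF k(1)] descent_tops_subset[OF \<sigma>] by auto
  have p: "card (?U \<inter> ?D) = p" by (simp add: p_def lpeak_def Lpeak_eq_Int)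
  have Un: "card (?U \<union> ?D) + p = n - k + 1" "2 * p \<le> n - k + 1"
    unfolding p_def using card_tops_Un[OF \<sigma> k] lpeak_le[OF \<sigma> k] by auto
  have "(\<Sum>S\<in>Pow {1..n}. x ^ desB n k (attach_signs \<sigma> S)) =
      (\<Sum>S\<in>Pow {1..n}. (\<Prod>i\<in>S. if i \<in> ?U then x else 1) *
        (\<Prod>i\<in>{1..n} - S. if i \<in> ?D then x else 1))"
  proof (rule sum.cong)
    fix S assume "S \<in> Pow {1..n}"
    then have "finite S" by (auto intro: finite_subset)
    then show "x ^ desB n k (attach_signs \<sigma> S) = (\<Prod>i\<in>S. if i \<in> ?U then x else 1) *
        (\<Prod>i\<in>{1..n} - S. if i \<in> ?D then x else 1)"
      by (simp add: desB_attach_signs[OF \<sigma> k(1)] prod_if_mem_power power_add)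
  qed simp
  \<comment> \<open>Expanding the product picks one summand at each position: the first for
    positions in \<open>S\<close>, the second for the others.\<close>
  also have "\<dots> = (\<Prod>i\<in>{1..n}. (if i \<in> ?U then x else 1) + (if i \<in> ?D then x else 1))"
    by (rule prod_add[symmetric]) simp
  also have "\<dots> = (2 * x) ^ p * (1 + x) ^ (card (?U \<union> ?D) - p) * 2 ^ (n - card (?U \<union> ?D))"
    by (subst prod_sum_indicators) (use UD p in auto)
  also have "\<dots> = 2 ^ (p + (n - card (?U \<union> ?D))) * x ^ p * (1 + x) ^ (card (?U \<union> ?D) - p)"
    by (simp add: power_mult_distrib power_add mult_ac)
  \<comment> \<open>The peaks give \<open>p\<close> factors 2. The positions in neither set give
    \<open>n - (n - k + 1 - p)\<close>, which is \<open>p + k - 1\<close>, further ones.\<close>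
  also have "p + (n - card (?U \<union> ?D)) = 2 * p + k - 1"
    using Un k by linarith
  also have "card (?U \<union> ?D) - p = n - k + 1 - 2 * p"
    using Un by linarith
  finally show ?thesis .
qed

theorem theorem17:
  fixes n k :: nat
  assumes "1 \<le> k" and "k \<le> n"
  shows "WB n k =
    (\<Sum>p = 0..(n - k + 1) div 2.
       of_nat (gammaB n k p) * [:0, 1:] ^ p * [:1, 1:] ^ (n - k + 1 - 2 * p))"
proof -
  let ?x = "[:0, 1:] :: int poly"
  let ?P = "{\<sigma>. \<sigma> permutes {1..n}}"
  define F where "F p = 2 ^ (2 * p + k - 1) * ?x ^ p * [:1, 1:] ^ (n - k + 1 - 2 * p)" for p
  have "1 + ?x = [:1, 1:]" by (simp add: one_pCons)
  then have "(\<Sum>S\<in>Pow {1..n}. ?x ^ desB n k (attach_signs \<sigma> S)) = F (lpeak n k \<sigma>)"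
    if "\<sigma> permutes {1..n}" for \<sigma>
    using sum_signs_desB[OF that assms, of ?x] by (simp only: F_def)
  then have "WB n k = (\<Sum>\<sigma>\<in>?P. F (lpeak n k \<sigma>))"
    unfolding WB_def sum_signed_perms by (intro sum.cong) (simp_all only: mem_Collect_eq)
  \<comment> \<open>Group by the number of left peaks; by \<open>lpeak_le\<close> every permutation
    falls within the range of \<open>p\<close>.\<close>
  also have "\<dots> = (\<Sum>p = 0..(n - k + 1) div 2. \<Sum>\<sigma> | \<sigma> \<in> ?P \<and> lpeak n k \<sigma> = p. F (lpeak n k \<sigma>))"
    by (rule sum.group[symmetric]) (use lpeak_le[OF _ assms] in \<open>fastforce simp: finite_permutations\<close>)+
  also have "\<dots> = (\<Sum>p = 0..(n - k + 1) div 2. of_nat (card (Gamma_l n k p)) * F p)"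
    by (intro sum.cong) (simp_all add: Gamma_l_def)
  finally show ?thesis
    by (simp add: F_def gammaB_def mult_ac)
qed

end
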